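(* Let $f$ be the Fibonacci sequence defined by $f(0) = 1$, $f(1) = 1$, and $f(n) = f(n-1) + f(n-2)$ for $n \geq 2$. Then for every integer $n \geq 2$, $$f(n) = 1 + \sum_{k=0}^{n-2} \sum_{i=0}^{n-k-2} \binom{k}{n-k-i-2}.$$
   Context: Binomial coefficient convention: $\binom{n}{r} = 0$ if $r < 0$ or $r > n$. *)

theory Defs
  imports Main
begin

text \<open>The Fibonacci sequence indexed from \<open>1, 1\<close>, so \<open>fibonacci n\<close> is the library's \<open>fib (Suc n)\<close>.\<close>

fun fibonacci :: "nat \<Rightarrow> nat" where
  "fibonacci 0 = 1"
| "fibonacci (Suc 0) = 1"
| "fibonacci (Suc (Suc n)) = fibonacci (Suc n) + fibonacci n"

end

theory Submission
  imports Defs "HOL-Number_Theory.Fib"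
begin

text \<open>Substituting \<open>j = n - 2 - k - i\<close> and grouping the terms by \<open>t = k + j\<close> turns the double sum into a
  sum over \<open>t \<le> n - 2\<close> of the diagonal sums of Pascal's triangle, which are the Fibonacci
  numbers. These telescope.\<close>

lemma fibonacci_eq_fib: "fibonacci n = fib (Suc n)"
  by (induction n rule: fibonacci.induct) simp_all

text \<open>The library's diagonal sum is indexed by the lower entry \<open>j\<close>; reversing it
  by \<open>k = t - j\<close> makes the upper entry the index.\<close>

lemma fibonacci_eq_sum_binomial: "fibonacci t = (\<Sum>k\<le>t. k choose (t - k))"
proof -
  have "fibonacci t = (\<Sum>j\<le>t. (t - j) choose j)"
    unfolding fibonacci_eq_fib by (simp flip: ne_diagonal_fib add: atLeast0AtMost)
  also have "\<dots> = (\<Sum>k\<le>t. k choose (t - k))"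
    by (rule sum.reindex_bij_witness[where i = "\<lambda>k. t - k" and j = "\<lambda>k. t - k"]) auto
  finally show ?thesis .
qed

text \<open>Telescoping of f(t) = f(t+2) - f(t+1); the summand 1 is f(1).\<close>

lemma fibonacci_Suc_Suc_eq_sum: "fibonacci (Suc (Suc m)) = 1 + (\<Sum>t\<le>m. fibonacci t)"
  by (induction m) simp_all

theorem theorem2p3:
  fixes n :: nat
  assumes "n \<ge> 2"
  shows "fibonacci n = 1 + (\<Sum>k = 0..n - 2. \<Sum>i = 0..n - k - 2. k choose (n - k - i - 2))"
proof -
  define m where "m = n - 2"
  have n: "n = Suc (Suc m)"
    using assms by (simp add: m_def)
  have "(\<Sum>t\<le>m. fibonacci t) = (\<Sum>t\<le>m. \<Sum>k\<le>t. k choose (t - k))"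
    by (simp add: fibonacci_eq_sum_binomial)
  \<comment> \<open>With \<open>j = t - k\<close>, the range \<open>k \<le> t \<le> m\<close>
    becomes the triangle \<open>k + j \<le> m\<close>.\<close>
  also have "\<dots> = (\<Sum>(k, j)\<in>{(k, j). k + j \<le> m}. k choose j)"
    by (rule sum.triangle_reindex_eq[symmetric])
  also have "{(k, j). k + j \<le> m} = (SIGMA k:{..m}. {..m - k})"
    by auto
  also have "(\<Sum>(k, j)\<in>\<dots>. k choose j) = (\<Sum>k\<le>m. \<Sum>j\<le>m - k. k choose j)"
    by (rule sum.Sigma[symmetric]) simp_all
  also have "\<dots> = (\<Sum>k\<le>m. \<Sum>i\<le>m - k. k choose (m - k - i))"
  proof (rule sum.cong[OF refl])
    fix k
    show "(\<Sum>j\<le>m - k. k choose j) = (\<Sum>i\<le>m - k. k choose (m - k - i))"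
      \<comment> \<open>Keeping \<open>m - k\<close> as one term lets the double subtraction
        cancel.\<close>
      by (rule sum.reindex_bij_witness[where i = "\<lambda>i. m - k - i" and j = "\<lambda>j. m - k - j"]) (simp_all del: diff_diff_left)
  qed
  also have "\<dots> = (\<Sum>k = 0..n - 2. \<Sum>i = 0..n - k - 2. k choose (n - k - i - 2))"
    unfolding atLeast0AtMost by (intro sum.cong) (auto simp: n)
  finally show ?thesis
    by (simp only: n fibonacci_Suc_Suc_eq_sum)
qed

end
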